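(* Let $n\ge2$, $s>0$, $0<\varepsilon<1$, $\mathtt H(y,x;\varepsilon)=\frac12|y|^2+\varepsilon f(x)$ with $f\in\mathbb B^n_s$, let the parameters be as in the context with $\mathtt K_{\rm o}\ge\mathtt b_0$, and let $\Psi_{\rm o}$ and $\Psi_k$ ($k\in\mathcal G^n_{\mathtt K_{\rm o}}$) be the averaging maps described in the context. Set $$\widetilde{\mathcal R}^0:=\mathrm{Re}(\mathcal R^0_{r_{\rm o}'/2}),\qquad\widetilde{\mathcal R}^{1,k}:=\mathrm{Re}(\mathcal R^{1,k}_{r_k'/2})\quad(k\in\mathcal G^n_{\mathtt K_{\rm o}}).$$ Then $$\mathcal R^0\times\mathbb T^n\subseteq\Psi_{\rm o}\big(\widetilde{\mathcal R}^0\times\mathbb T^n\big),\qquad \mathcal R^{1,k}\times\mathbb T^n\subseteq\Psi_k\big(\widetilde{\mathcal R}^{1,k}\times\mathbb T^n\big)\quad\forall k\in\mathcal G^n_{\mathtt K_{\rm o}},$$ $$\mathcal R^2:=\mathrm B\setminus(\mathcal R^0\cup\mathcal R^1)\subseteq\bigcup_{k\in\mathcal G^n_{\mathtt K_{\rm o}}}\ \bigcup_{\ell\in\mathcal G^n_{\mathtt K},\,\ell\notin\mathbb Zk}\mathcal R^2_{k,\ell},$$ where, for $k\in\mathcal G^n_{\mathtt K_{\rm o}}$ and $\ell\in\mathcal G^n_{\mathtt K}\setminus\mathbb Zk$, $\mathcal R^2_{k,\ell}:=\{y\in\mathrm B:|y\cdot k|<\alpha,\ |\mathtt p_k^\perp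 y\cdot\ell|\le\frac{3\alpha\mathtt K}{|k|}\}$.
   Context: **Functions.** $\mathbb T^n=\mathbb R^n/(2\pi\mathbb Z^n)$; $\mathbb T^n_\sigma=\{x\in\mathbb C^n:|\mathrm{Im}\,x_j|<\sigma\ \forall j\}/(2\pi\mathbb Z^n)$. $|k|_1=\sum|k_j|$, $|\cdot|$ is the Euclidean norm. $\mathbb B^n_s$ is the set of zero-average real analytic functions $f=\sum_{k\in\mathbb Z^n}f_ke^{ik\cdot x}$ on $\mathbb T^n$ with $\sup_k|f_k|e^{|k|_1s}\le1$. $\mathcal G^n$ is the set of $k\in\mathbb Z^n\setminus\{0\}$ whose first non-null component is positive and with $\gcd(k_1,\dots,k_n)=1$; $\mathcal G^n_K=\{k\in\mathcal G^n:|k|_1\le K\}$. $\pi_{\mathbb Zk}f(\theta):=\sum_{j\in\mathbb Z}f_{jk}e^{ij\theta}$. For $V\subseteq\mathbb R^n$, $V_r=\bigcup_{y\in V}\{z\in\mathbb C^n:|z-y|<r\}$ and $\mathrm{Re}(V_r)=V_r\cap\mathbb R^n$. $|\cdot|_r$, $|\cdot|_{r,\sigma}$ are sup-norms on $V_r$, $V_r\times\mathbb T^n_\sigma$, and $\|g\|^*_{r,\sigma}:=\sup_{y\in V_r}\sum_k|g_k(y)|e^{|k|_1\sigma}$ ($g_k(y)$ Fourier coefficients of $g(y,\cdot)$). **Parameters.** $\mathtt K\ge6\mathtt K_{\rm o}\ge12$, $\nu=\frac92n+2$, $\alpha=\sqrt\varepsilon\,\mathtt K^\nu$, $r_{\rm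 o}=\frac{\alpha}{16\mathtt K_{\rm o}}$, $r_{\rm o}'=\frac{r_{\rm o}}2$, $s_{\rm o}=s(1-\frac1{\mathtt K_{\rm o}})$, $s_{\rm o}'=s_{\rm o}(1-\frac1{\mathtt K_{\rm o}})$, $s_\star=s(1-\frac1{\mathtt K})$, $s_\star'=s_\star(1-\frac1{\mathtt K})$; for $k\in\mathcal G^n_{\mathtt K_{\rm o}}$: $r_k=\alpha/|k|$, $r_k'=r_k/2$, $s_k'=|k|_1s_\star'$. **Sets.** $\mathrm B=\{y\in\mathbb R^n:|y|<1\}$; $\mathtt p_ky=(y\cdot k)k/|k|^2$, $\mathtt p_k^\perp y=y-\mathtt p_ky$; $\mathcal R^0=\{y\in\mathrm B:\min_{k\in\mathcal G^n_{\mathtt K_{\rm o}}}|y\cdot k|>\frac\alpha2\}$; $\mathcal R^{1,k}=\{y\in\mathrm B:|y\cdot k|<\alpha,\ |\mathtt p_k^\perp y\cdot\ell|>\frac{3\alpha\mathtt K}{|k|}\ \forall\ell\in\mathcal G^n_{\mathtt K}\setminus\mathbb Zk\}$; $\mathcal R^1=\bigcup_{k\in\mathcal G^n_{\mathtt K_{\rm o}}}\mathcal R^{1,k}$. **Averaging maps.** By the paper's Averaging Lemma there is a constant $\mathtt b_0=\mathtt b_0(n,s)>1$ such that, if $\mathtt K_{\rm o}\ge\mathtt b_0$, there exist real analytic symplectic (w.r.t. $\sum dy_j\wedge dx_j$) maps $\Psi_{\rm o}:\mathcal R^0_{r_{\rm o}'}\times\mathbb T^n_{s_{\rm o}'}\to\mathcal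 R^0_{r_{\rm o}}\times\mathbb T^n_{s_{\rm o}}$ and $\Psi_k:\mathcal R^{1,k}_{r_k'}\times\mathbb T^n_{s_\star'}\to\mathcal R^{1,k}_{r_k}\times\mathbb T^n_{s_\star}$ ($k\in\mathcal G^n_{\mathtt K_{\rm o}}$) such that: (a) $\mathtt H\circ\Psi_{\rm o}=\frac{|y|^2}2+\varepsilon(g^{\rm o}(y)+f^{\rm o}(y,x))$, $f^{\rm o}$ with zero $x$-average, $|g^{\rm o}|_{r_{\rm o}'}\le\mathtt K^{-6n-1}$, $\|f^{\rm o}\|^*_{r_{\rm o}',s_{\rm o}'}\le e^{-\mathtt K_{\rm o}s/3}$; (b) $\mathtt H\circ\Psi_k=\frac{|y|^2}2+\varepsilon(g^k_{\rm o}(y)+g^k(y,k\cdot x)+f^k(y,x))$, $\pi_{\mathbb Zk}f^k=0$, $g^k(y,\cdot)$ with zero average, $|g^k_{\rm o}|_{r_k'}\le\mathtt K^{-6n-1}$, $\|g^k-\pi_{\mathbb Zk}f\|^*_{r_k',s_k'}\le\mathtt K^{-6n-1}$, $\|f^k\|^*_{r_k',s_\star/2}\le e^{-\mathtt Ks/3}$; (c) denoting by $\pi_y,\pi_x$ the projections on the $y$ and $x$ variables, $|\pi_y\Psi_{\rm o}-y|_{r_{\rm o}',s_{\rm o}'}\le\frac{r_{\rm o}}{2^7\mathtt K_{\rm o}}$, $|\pi_y\Psi_k-y|_{r_k',s_\star'}\le\frac{r_k}{2^7\mathtt K}$ and, for every fixed $y$, $\pi_x\Psi_{\rm o}(y,\cdot)$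 and $\pi_x\Psi_k(y,\cdot)$ are diffeomorphisms of $\mathbb T^n$. The maps $\Psi_{\rm o},\Psi_k$ in the claim are these maps. *)

theory Defs
  imports "HOL-Analysis.Analysis"
begin

section \<open>Integer, real and complex vectors\<close>

definition rvec :: "int^'n \<Rightarrow> real^'n" where
  "rvec k = (\<chi> j. real_of_int (k $ j))"

definition cvec :: "real^'n \<Rightarrow> complex^'n" where
  "cvec x = (\<chi> j. complex_of_real (x $ j))"

definition norm1 :: "int^'n::finite \<Rightarrow> real" where
  "norm1 k = (\<Sum>j\<in>UNIV. real_of_int \<bar>k $ j\<bar>)"

definition kdot :: "int^'n::finite \<Rightarrow> complex^'n \<Rightarrow> complex" where
  "kdot k x = (\<Sum>j\<in>UNIV. of_int (k $ j) * x $ j)"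

text \<open>The linear order on the index type is only used to speak of the first non-null component.\<close>

definition gens :: "(int^'n::{finite,linorder}) set" where
  "gens = {k. k \<noteq> 0 \<and> (\<exists>j. k $ j > 0 \<and> (\<forall>i<j. k $ i = 0)) \<and> Gcd (range (\<lambda>j. k $ j)) = 1}"

definition gens_upto :: "real \<Rightarrow> (int^'n::{finite,linorder}) set" where
  "gens_upto K = {k \<in> gens. norm1 k \<le> K}"

definition int_line :: "int^'n \<Rightarrow> (int^'n) set" where
  "int_line k = range (\<lambda>j. j *s k)"


section \<open>Complex neighbourhoods, strips and tori\<close>

definition cnbhd :: "(real^'n::finite) set \<Rightarrow> real \<Rightarrow> (complex^'n) set" where
  "cnbhd V r = (\<Union>y\<in>V. {z. norm (z - cvec y) < r})"

definition real_part :: "(complex^'n) set \<Rightarrow> (real^'n) set" where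
  "real_part W = {y. cvec y \<in> W}"

definition strip :: "real \<Rightarrow> (complex^'n) set" where
  "strip \<sigma> = {x. \<forall>j. \<bar>Im (x $ j)\<bar> < \<sigma>}"

definition period :: "int^'n \<Rightarrow> complex^'n" where
  "period m = cvec ((2 * pi) *\<^sub>R rvec m)"

definition torus_rel :: "complex^'n \<Rightarrow> complex^'n \<Rightarrow> bool" where
  "torus_rel x x' \<longleftrightarrow> (\<exists>m. x' = x + period m)"

lemma period_zero: "period 0 = 0"
  by (simp add: period_def cvec_def rvec_def vec_eq_iff)

lemma period_add: "period (m + m') = period m + period m'"
  by (simp add: period_def cvec_def rvec_def vec_eq_iff algebra_simps)

lemma period_minus: "period (- m) = - period m"
  by (simp add: period_def cvec_def rvec_def vec_eq_iff)

lemma equivp_torus_rel: "equivp torus_rel"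
proof (rule equivpI)
  show "reflp torus_rel"
    by (rule reflpI) (auto simp: torus_rel_def intro: exI[of _ 0] simp: period_zero)
  show "symp torus_rel"
  proof (rule sympI)
    fix x x' :: "complex^'n" assume "torus_rel x x'"
    then obtain m where "x' = x + period m" by (auto simp: torus_rel_def)
    then have "x = x' + period (- m)" by (simp add: period_minus)
    then show "torus_rel x' x" unfolding torus_rel_def by blast
  qed
  show "transp torus_rel"
  proof (rule transpI)
    fix x y z :: "complex^'n" assume "torus_rel x y" "torus_rel y z"
    then obtain m m' where "y = x + period m" "z = y + period m'" by (auto simp: torus_rel_def)
    then have "z = x + period (m + m')" by (simp add: period_add)
    then show "torus_rel x z" unfolding torus_rel_def by blast
  qed
qed

text \<open>The complex torus; \<open>torus_of\<close> is the projection from its covering space.\<close>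

quotient_type 'n ctorus = "complex^'n::finite" / torus_rel
  morphisms torus_rep torus_of
  by (rule equivp_torus_rel)

text \<open>The phase space: actions and angles.\<close>

type_synonym 'n phase = "(complex, 'n) vec \<times> 'n ctorus"

definition ctorus_strip :: "real \<Rightarrow> ('n::finite ctorus) set" where
  "ctorus_strip \<sigma> = torus_of ` strip \<sigma>"

definition rtorus :: "('n::finite ctorus) set" where
  "rtorus = torus_of ` range cvec"


section \<open>Analytic and smooth functions\<close>

text \<open>In several variables holomorphic means Frechet differentiable with complex linear
  derivative; the sets below are always open.\<close>

definition holomorphic1_on :: "(complex^'n::finite \<Rightarrow> complex) \<Rightarrow> (complex^'n) set \<Rightarrow> bool" where
  "holomorphic1_on F S \<longleftrightarrow>
     (\<forall>z\<in>S. \<exists>D. (F has_derivative D) (at z) \<and> (\<forall>c v. D (c *s v) = c * D v))"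

definition holomorphic2_on ::
    "((complex^'n::finite) \<times> (complex^'m::finite) \<Rightarrow> complex) \<Rightarrow> ((complex^'n) \<times> (complex^'m)) set \<Rightarrow> bool" where
  "holomorphic2_on F S \<longleftrightarrow>
     (\<forall>z\<in>S. \<exists>D. (F has_derivative D) (at z) \<and> (\<forall>c u v. D (c *s u, c *s v) = c * D (u, v)))"

primrec Ck_on :: "nat \<Rightarrow> ('a::real_normed_vector \<Rightarrow> 'b::real_normed_vector) \<Rightarrow> 'a set \<Rightarrow> bool" where
  "Ck_on 0 h U \<longleftrightarrow> continuous_on U h"
| "Ck_on (Suc m) h U \<longleftrightarrow>
     (\<forall>x\<in>U. h differentiable (at x)) \<and> (\<forall>v. Ck_on m (\<lambda>x. frechet_derivative h (at x) v) U)"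

text \<open>Scalar functions on a torus are represented by periodic functions on its covering space.\<close>

definition real_analytic_y :: "(complex^'n::finite) set \<Rightarrow> (complex^'n \<Rightarrow> complex) \<Rightarrow> bool" where
  "real_analytic_y W g \<longleftrightarrow> holomorphic1_on g W \<and> (\<forall>y. cvec y \<in> W \<longrightarrow> g (cvec y) \<in> \<real>)"

definition real_analytic_yx ::
    "(complex^'n::finite) set \<Rightarrow> real \<Rightarrow> (complex^'n \<Rightarrow> complex^'m::finite \<Rightarrow> complex) \<Rightarrow> bool" where
  "real_analytic_yx W \<sigma> g \<longleftrightarrow>
     holomorphic2_on (\<lambda>(y, x). g y x) (W \<times> strip \<sigma>) \<and>
     (\<forall>y\<in>W. \<forall>x\<in>strip \<sigma>. \<forall>m. g y (x + period m) = g y x) \<and>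
     (\<forall>y x. cvec y \<in> W \<longrightarrow> g (cvec y) (cvec x) \<in> \<real>)"


section \<open>Fourier coefficients and norms\<close>

definition fourier :: "(real^'m::finite \<Rightarrow> complex) \<Rightarrow> int^'m \<Rightarrow> complex" where
  "fourier h k = (1 / (2 * pi) ^ CARD('m)) *\<^sub>R
     integral (cbox 0 (\<chi> j. 2 * pi)) (\<lambda>x. h x * exp (- \<i> * kdot k (cvec x)))"

text \<open>Fourier coefficients of the restriction of a function to the real torus.\<close>

definition cfourier :: "(complex^'m::finite \<Rightarrow> complex) \<Rightarrow> int^'m \<Rightarrow> complex" where
  "cfourier F = fourier (\<lambda>x. F (cvec x))"

text \<open>The holomorphic extension to the strip of a function on the real torus, given by its
  Fourier series.\<close>

definition cext :: "(real^'n::finite \<Rightarrow> real) \<Rightarrow> complex^'n \<Rightarrow> complex" where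
  "cext f x = (\<Sum>\<^sub>\<infinity>k\<in>UNIV. fourier (\<lambda>x. complex_of_real (f x)) k * exp (\<i> * kdot k x))"

definition analytic_class :: "real \<Rightarrow> (real^'n::finite \<Rightarrow> real) set" where
  "analytic_class s = {f.
     (\<forall>x m. f (x + (2 * pi) *\<^sub>R rvec m) = f x) \<and>
     (\<exists>U F. open U \<and> range cvec \<subseteq> U \<and> holomorphic1_on F U \<and>
        (\<forall>x. F (cvec x) = complex_of_real (f x))) \<and>
     (\<forall>x. ((\<lambda>k. fourier (\<lambda>x. complex_of_real (f x)) k * exp (\<i> * kdot k (cvec x)))
        has_sum complex_of_real (f x)) UNIV) \<and>
     fourier (\<lambda>x. complex_of_real (f x)) 0 = 0 \<and>
     (SUP k. ennreal (norm (fourier (\<lambda>x. complex_of_real (f x)) k) * exp (norm1 k * s))) \<le> 1}"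

text \<open>The one-dimensional torus is the case of index type \<open>1\<close>, so that the angle is \<open>\<theta> $ 1\<close>.\<close>

definition proj_line :: "int^'n::finite \<Rightarrow> (complex^'n \<Rightarrow> complex) \<Rightarrow> complex^1 \<Rightarrow> complex" where
  "proj_line k F \<theta> = (\<Sum>\<^sub>\<infinity>j\<in>UNIV. cfourier F (j *s k) * exp (\<i> * of_int j * \<theta> $ 1))"

definition sup_norm :: "'a set \<Rightarrow> ('a \<Rightarrow> 'b::real_normed_vector) \<Rightarrow> ennreal" where
  "sup_norm S F = (SUP z\<in>S. ennreal (norm (F z)))"

definition star_norm ::
    "(complex^'n) set \<Rightarrow> real \<Rightarrow> (complex^'n \<Rightarrow> complex^'m::finite \<Rightarrow> complex) \<Rightarrow> ennreal" where
  "star_norm W \<sigma> g =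
     (SUP y\<in>W. \<Sum>\<^sub>\<infinity>k\<in>UNIV. ennreal (norm (cfourier (g y) k) * exp (norm1 k * \<sigma>)))"


section \<open>Symplectic maps and torus diffeomorphisms\<close>

definition symp_form ::
    "(complex^'n::finite) \<times> (complex^'n) \<Rightarrow> (complex^'n) \<times> (complex^'n) \<Rightarrow> complex" where
  "symp_form u v = (\<Sum>j\<in>UNIV. fst u $ j * snd v $ j - fst v $ j * snd u $ j)"

text \<open>Torus-valued maps are analytic (smooth) if they have local analytic (smooth) lifts to the
  covering space; the complex domain need not be simply connected, so no global lift is required.\<close>

definition real_analytic_symplectic ::
    "(real^'n::finite) set \<Rightarrow> real \<Rightarrow> real \<Rightarrow> real \<Rightarrow> real \<Rightarrow>
     ('n phase \<Rightarrow> 'n phase) \<Rightarrow> bool" where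
  "real_analytic_symplectic V r' \<sigma>' r \<sigma> \<Psi> \<longleftrightarrow>
     \<Psi> ` (cnbhd V r' \<times> ctorus_strip \<sigma>') \<subseteq> cnbhd V r \<times> ctorus_strip \<sigma> \<and>
     \<Psi> ` (cvec ` real_part (cnbhd V r') \<times> rtorus) \<subseteq> range cvec \<times> rtorus \<and>
     (\<forall>z \<in> cnbhd V r' \<times> strip \<sigma>'. \<exists>U F. open U \<and> z \<in> U \<and> U \<subseteq> cnbhd V r' \<times> strip \<sigma>' \<and>
        (\<forall>(y, x) \<in> U. \<Psi> (y, torus_of x) = (fst (F (y, x)), torus_of (snd (F (y, x))))) \<and>
        (\<forall>p\<in>U. \<exists>D. (F has_derivative D) (at p) \<and>
           (\<forall>c u v. D (c *s u, c *s v) = (c *s fst (D (u, v)), c *s snd (D (u, v)))) \<and>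
           (\<forall>v w. symp_form (D v) (D w) = symp_form v w)))"

definition torus_smooth :: "('n::finite ctorus \<Rightarrow> 'n ctorus) \<Rightarrow> bool" where
  "torus_smooth \<phi> \<longleftrightarrow> (\<forall>x0 :: real^'n. \<exists>U h. open U \<and> x0 \<in> U \<and> (\<forall>m. Ck_on m h U) \<and>
     (\<forall>x\<in>U. \<phi> (torus_of (cvec x)) = torus_of (cvec (h x))))"

definition torus_diffeo :: "('n::finite ctorus \<Rightarrow> 'n ctorus) \<Rightarrow> bool" where
  "torus_diffeo \<phi> \<longleftrightarrow> bij_betw \<phi> rtorus rtorus \<and> torus_smooth \<phi> \<and> torus_smooth (inv_into rtorus \<phi>)"


section \<open>Resonant and non-resonant sets\<close>

text \<open>\<open>shrink (shrink s Ko) Ko\<close> and \<open>shrink (shrink s K) K\<close> are the twice reduced analyticity widths.\<close>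

definition shrink :: "real \<Rightarrow> real \<Rightarrow> real" where
  "shrink s K = s * (1 - 1 / K)"

definition rad_o :: "real \<Rightarrow> real \<Rightarrow> real" where
  "rad_o \<alpha> Ko = \<alpha> / (16 * Ko)"

definition rad :: "real \<Rightarrow> int^'n::finite \<Rightarrow> real" where
  "rad \<alpha> k = \<alpha> / norm (rvec k)"

definition proj_par :: "int^'n::finite \<Rightarrow> real^'n \<Rightarrow> real^'n" where
  "proj_par k y = ((y \<bullet> rvec k) / (norm (rvec k))\<^sup>2) *\<^sub>R rvec k"

definition proj_perp :: "int^'n::finite \<Rightarrow> real^'n \<Rightarrow> real^'n" where
  "proj_perp k y = y - proj_par k y"

definition R0 :: "real \<Rightarrow> real \<Rightarrow> (real^'n::{finite,linorder}) set" where
  "R0 \<alpha> Ko = {y \<in> ball 0 1. Min ((\<lambda>k. \<bar>y \<bullet> rvec k\<bar>) ` gens_upto Ko) > \<alpha> / 2}"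

definition R1k :: "real \<Rightarrow> real \<Rightarrow> (int, 'n) vec \<Rightarrow> (real^'n::{finite,linorder}) set" where
  "R1k \<alpha> K k = {y \<in> ball 0 1. \<bar>y \<bullet> rvec k\<bar> < \<alpha> \<and>
     (\<forall>l \<in> gens_upto K - int_line k. \<bar>proj_perp k y \<bullet> rvec l\<bar> > 3 * \<alpha> * K / norm (rvec k))}"

definition R1 :: "real \<Rightarrow> real \<Rightarrow> real \<Rightarrow> (real^'n::{finite,linorder}) set" where
  "R1 \<alpha> Ko K = (\<Union>k\<in>gens_upto Ko. R1k \<alpha> K k)"

definition R2 :: "real \<Rightarrow> real \<Rightarrow> real \<Rightarrow> (real^'n::{finite,linorder}) set" where
  "R2 \<alpha> Ko K = ball 0 1 - (R0 \<alpha> Ko \<union> R1 \<alpha> Ko K)"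

definition R2kl :: "real \<Rightarrow> real \<Rightarrow> int^'n \<Rightarrow> int^'n \<Rightarrow> (real^'n::finite) set" where
  "R2kl \<alpha> K k l = {y \<in> ball 0 1. \<bar>y \<bullet> rvec k\<bar> < \<alpha> \<and>
     \<bar>proj_perp k y \<bullet> rvec l\<bar> \<le> 3 * \<alpha> * K / norm (rvec k)}"

definition R0_tilde :: "real \<Rightarrow> real \<Rightarrow> (real^'n::{finite,linorder}) set" where
  "R0_tilde \<alpha> Ko = real_part (cnbhd (R0 \<alpha> Ko) ((rad_o \<alpha> Ko / 2) / 2))"

definition R1k_tilde :: "real \<Rightarrow> real \<Rightarrow> (int, 'n) vec \<Rightarrow> (real^'n::{finite,linorder}) set" where
  "R1k_tilde \<alpha> K k = real_part (cnbhd (R1k \<alpha> K k) ((rad \<alpha> k / 2) / 2))"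


section \<open>The averaging maps\<close>

text \<open>The complexified Hamiltonian: \<open>|y|\<^sup>2\<close> extends holomorphically as the sum of the squares of
  the components, not as the Hermitian norm.\<close>

definition csq :: "complex^'n::finite \<Rightarrow> complex" where
  "csq y = (\<Sum>j\<in>UNIV. (y $ j)\<^sup>2)"

definition Ham :: "real \<Rightarrow> (real^'n::finite \<Rightarrow> real) \<Rightarrow> (complex^'n) \<times> (complex^'n) \<Rightarrow> complex" where
  "Ham \<epsilon> f = (\<lambda>(y, x). csq y / 2 + of_real \<epsilon> * cext f x)"

text \<open>\<open>H \<circ> \<Psi> = G\<close> on \<open>W \<times> T_\<sigma>\<close>, with angles read on the covering space.\<close>

definition Ham_conj ::
    "real \<Rightarrow> (real^'n::finite \<Rightarrow> real) \<Rightarrow> (complex^'n) set \<Rightarrow> real \<Rightarrow>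
     ('n phase \<Rightarrow> 'n phase) \<Rightarrow> (complex^'n \<Rightarrow> complex^'n \<Rightarrow> complex) \<Rightarrow> bool" where
  "Ham_conj \<epsilon> f W \<sigma> \<Psi> G \<longleftrightarrow>
     (\<forall>y\<in>W. \<forall>x\<in>strip \<sigma>. \<forall>y' x'. \<Psi> (y, torus_of x) = (y', torus_of x') \<longrightarrow> Ham \<epsilon> f (y', x') = G y x)"

text \<open>Analyticity of the functions \<open>go\<close>, \<open>fo\<close>, \<open>gko\<close>, \<open>gk\<close>, \<open>fk\<close> below already follows from the
  analyticity of \<open>\<Psi>\<close> and the normalisations of their Fourier coefficients; it is stated so that these
  coefficients are visibly meaningful. The angle map is a self-map of the real torus only for real
  actions, hence the restriction of the last condition to \<open>real_part W\<close>.\<close>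

definition averaging_map_o ::
    "(real^'n::{finite,linorder} \<Rightarrow> real) \<Rightarrow> real \<Rightarrow> real \<Rightarrow> real \<Rightarrow> real \<Rightarrow> real \<Rightarrow>
     ('n phase \<Rightarrow> 'n phase) \<Rightarrow> bool" where
  "averaging_map_o f s \<epsilon> Ko K \<alpha> \<Psi> \<longleftrightarrow>
    (let V = R0 \<alpha> Ko :: (real^_) set; r = rad_o \<alpha> Ko; r' = r / 2;
         so = shrink s Ko; so' = shrink so Ko; W = cnbhd V r'
     in real_analytic_symplectic V r' so' r so \<Psi> \<and>
        (\<exists>go fo.
           real_analytic_y W go \<and> real_analytic_yx W so' fo \<and>
           Ham_conj \<epsilon> f W so' \<Psi> (\<lambda>y x. csq y / 2 + of_real \<epsilon> * (go y + fo y x)) \<and>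
           (\<forall>y\<in>W. cfourier (fo y) 0 = 0) \<and>
           sup_norm W go \<le> ennreal (K powr (- 6 * real CARD('n) - 1)) \<and>
           star_norm W so' fo \<le> ennreal (exp (- Ko * s / 3))) \<and>
        sup_norm (W \<times> ctorus_strip so') (\<lambda>p. fst (\<Psi> p) - fst p) \<le> ennreal (r / (2 ^ 7 * Ko)) \<and>
        (\<forall>y\<in>real_part W. torus_diffeo (\<lambda>x. snd (\<Psi> (cvec y, x)))))"

definition averaging_map_k ::
    "(real^'n::{finite,linorder} \<Rightarrow> real) \<Rightarrow> real \<Rightarrow> real \<Rightarrow> real \<Rightarrow> real \<Rightarrow> (int, 'n) vec \<Rightarrow>
     ('n phase \<Rightarrow> 'n phase) \<Rightarrow> bool" where
  "averaging_map_k f s \<epsilon> K \<alpha> k \<Psi> \<longleftrightarrow>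
    (let V = R1k \<alpha> K k :: (real^_) set; r = rad \<alpha> k; r' = r / 2;
         ss = shrink s K; ss' = shrink ss K; sk' = norm1 k * ss'; W = cnbhd V r'
     in real_analytic_symplectic V r' ss' r ss \<Psi> \<and>
        (\<exists>gko gk fk.
           real_analytic_y W gko \<and> real_analytic_yx W sk' (gk :: _ \<Rightarrow> complex^1 \<Rightarrow> _) \<and>
           real_analytic_yx W ss' fk \<and>
           Ham_conj \<epsilon> f W ss' \<Psi>
             (\<lambda>y x. csq y / 2 + of_real \<epsilon> * (gko y + gk y (vec (kdot k x)) + fk y x)) \<and>
           (\<forall>y\<in>W. \<forall>\<theta>\<in>strip sk'. proj_line k (fk y) \<theta> = 0) \<and>
           (\<forall>y\<in>W. cfourier (gk y) 0 = 0) \<and>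
           sup_norm W gko \<le> ennreal (K powr (- 6 * real CARD('n) - 1)) \<and>
           star_norm W sk' (\<lambda>y \<theta>. gk y \<theta> - proj_line k (cext f) \<theta>)
             \<le> ennreal (K powr (- 6 * real CARD('n) - 1)) \<and>
           star_norm W (ss / 2) fk \<le> ennreal (exp (- K * s / 3))) \<and>
        sup_norm (W \<times> ctorus_strip ss') (\<lambda>p. fst (\<Psi> p) - fst p) \<le> ennreal (r / (2 ^ 7 * K)) \<and>
        (\<forall>y\<in>real_part W. torus_diffeo (\<lambda>x. snd (\<Psi> (cvec y, x)))))"

end

theory Submission
  imports Defs
begin

text \<open>
  An averaging map moves the actions by much less than the gap between a set and the
  neighbourhood on which it is used, and for each fixed real action it permutes the real angles.
  To reach \<open>(a, t)\<close>, choose for each action \<open>y\<close> near \<open>a\<close> the unique angle \<open>x(y)\<close> that the map sends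
  to \<open>t\<close>. The remaining equation says that \<open>y\<close> is a fixed point of \<open>a\<close> minus the displacement of
  the action at \<open>(y, x(y))\<close>. This sends the closed ball around \<open>a\<close> whose radius is the
  displacement bound into itself, so Brouwer's theorem applies once it is continuous in \<open>y\<close>.

  Continuity comes from compactness: over that ball, the
  angles sent to \<open>t\<close> form a compact set, because the torus is compact and the condition on
  the image is closed. The image action, as a function of \<open>y\<close>, then has a compact graph. This is
  \<open>hits_centre_if_displacement_small\<close>, and \<open>covers_if_displacement_small\<close> transfers it to maps of
  the phase space.

  The inclusion for the doubly resonant set is \<open>R2_covered\<close>: an action outside the non-resonant
  set is resonant with some generator \<open>k\<close> of low order, and if it is not in the simply resonant
  set of this \<open>k\<close>, then a second, independent generator \<open>l\<close> witnesses it.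
\<close>

section \<open>Surjectivity of a small displacement along a compact fibre relation\<close>

text \<open>The set \<open>A\<close> plays the role of a compact, possibly multivalued, choice of a second coordinate
  over each point of the ball. As \<open>P\<close> does not depend on this choice, it descends to a function of
  the first coordinate with compact graph, hence to a continuous one. A relation is
  the right setting for angle coordinates, since several of them represent the same point of the
  torus.\<close>

lemma hits_centre_if_displacement_small:
  fixes A :: "('a::euclidean_space \<times> 'b::euclidean_space) set" and P :: "'a \<times> 'b \<Rightarrow> 'a"
  assumes "compact A" and cont: "continuous_on A P" and onto: "fst ` A = cball a \<rho>" and "\<rho> > 0"
    and const: "\<And>y \<xi> \<xi>'. (y, \<xi>) \<in> A \<Longrightarrow> (y, \<xi>') \<in> A \<Longrightarrow> P (y, \<xi>) = P (y, \<xi>')"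
    and small: "\<And>y \<xi>. (y, \<xi>) \<in> A \<Longrightarrow> norm (P (y, \<xi>) - y) \<le> \<rho>"
  shows "\<exists>y \<xi>. (y, \<xi>) \<in> A \<and> P (y, \<xi>) = a"
proof -
  have "\<exists>\<xi>. (y, \<xi>) \<in> A" if "y \<in> cball a \<rho>" for y
    using that onto[symmetric] by auto
  then obtain \<xi> where \<xi>: "\<And>y. y \<in> cball a \<rho> \<Longrightarrow> (y, \<xi> y) \<in> A"
    by metis
  define G where "G = (\<lambda>y. P (y, \<xi> y))"
  \<comment> \<open>The graph of \<open>G\<close> is a continuous image of \<open>A\<close>, whatever selection \<open>\<xi>\<close> was made.\<close>
  have graph: "(\<lambda>y. (y, G y)) ` cball a \<rho> = (\<lambda>p. (fst p, P p)) ` A"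
  proof (intro equalityI subsetI)
    fix q assume "q \<in> (\<lambda>y. (y, G y)) ` cball a \<rho>"
    then obtain y where "y \<in> cball a \<rho>" "q = (y, P (y, \<xi> y))"
      by (auto simp: G_def)
    then show "q \<in> (\<lambda>p. (fst p, P p)) ` A"
      using \<xi> by (force intro!: image_eqI[of _ _ "(y, \<xi> y)"])
  next
    fix q assume "q \<in> (\<lambda>p. (fst p, P p)) ` A"
    then obtain y \<eta> where *: "(y, \<eta>) \<in> A" "q = (y, P (y, \<eta>))"
      by auto
    then have y: "y \<in> cball a \<rho>"
      using onto by force
    with * \<xi> const have "q = (y, G y)"
      by (metis G_def)
    with y show "q \<in> (\<lambda>y. (y, G y)) ` cball a \<rho>"
      by blast
  qed
  have "compact ((\<lambda>p. (fst p, P p)) ` A)"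
    by (intro compact_continuous_image continuous_intros cont \<open>compact A\<close>)
  then have "closed ((\<lambda>y. (y, G y)) ` cball a \<rho>)"
    unfolding graph by (rule compact_imp_closed)
  moreover have "compact (P ` A)"
    using cont \<open>compact A\<close> by (rule compact_continuous_image)
  moreover have "G \<in> cball a \<rho> \<rightarrow> P ` A"
    using \<xi> by (auto simp: G_def)
  ultimately have contG: "continuous_on (cball a \<rho>) G"
    by (intro continuous_from_closed_graph)
  have maps: "(\<lambda>y. a - (G y - y)) \<in> cball a \<rho> \<rightarrow> cball a \<rho>"
    using small[OF \<xi>] by (auto simp: G_def dist_norm norm_minus_commute)
  have contT: "continuous_on (cball a \<rho>) (\<lambda>y. a - (G y - y))"
    by (intro continuous_intros contG)
  obtain y where "y \<in> cball a \<rho>" "a - (G y - y) = y"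
    using brouwer_ball[OF \<open>\<rho> > 0\<close> contT maps] .
  then show ?thesis
    using \<xi> by (auto simp: G_def)
qed

section \<open>Real vectors, the period lattice and the real torus\<close>

lemma cvec_diff: "cvec (x - y) = cvec x - cvec y"
  by (simp add: cvec_def vec_eq_iff)

lemma norm_cvec: "norm (cvec x) = norm x"
  by (simp add: cvec_def norm_vec_def)

lemma continuous_on_cvec [continuous_intros]:
  "continuous_on S g \<Longrightarrow> continuous_on S (\<lambda>x. cvec (g x))"
  unfolding cvec_def by (intro continuous_intros)

lemma closed_periods: "closed (range (period :: int^'n \<Rightarrow> complex^'n::finite))"
proof -
  have "range period = {z :: complex^'n. \<forall>j. z $ j / complex_of_real (2 * pi) \<in> \<int>}"
  proof (intro equalityI subsetI)
    fix z :: "complex^'n" assume "z \<in> {z. \<forall>j. z $ j / complex_of_real (2 * pi) \<in> \<int>}"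
    then have "\<exists>i. z $ j / complex_of_real (2 * pi) = of_int i" for j
      by (auto elim: Ints_cases)
    then obtain i where i: "\<And>j. z $ j / complex_of_real (2 * pi) = of_int (i j)"
      by metis
    have "z $ j = complex_of_real (2 * pi) * of_int (i j)" for j
      using i[of j] by (simp add: field_simps)
    then have "z = period (\<chi> j. i j)"
      by (simp add: period_def cvec_def rvec_def vec_eq_iff)
    then show "z \<in> range period"
      by blast
  qed (auto simp: period_def cvec_def rvec_def)
  moreover have "closed {z :: complex^'n. z $ j / complex_of_real (2 * pi) \<in> \<int>}" for j
  proof -
    have "closed ((\<lambda>z :: complex^'n. z $ j / complex_of_real (2 * pi)) -` \<int>)"
      by (intro continuous_closed_vimage closed_Ints continuous_intros) auto
    then show ?thesis
      by (simp add: vimage_def)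
  qed
  ultimately show ?thesis
    by (simp add: closed_Collect_all)
qed

lemma torus_of_eq_iff: "torus_of x = torus_of x' \<longleftrightarrow> x' - x \<in> range period"
proof -
  have "x' = x + period m \<longleftrightarrow> x' - x = period m" for m
    by (auto simp: algebra_simps)
  then show ?thesis
    by (auto simp: ctorus.abs_eq_iff torus_rel_def)
qed

lemma rtorus_representative:
  assumes "t \<in> rtorus"
  shows "\<exists>\<xi> \<in> cbox 0 (\<chi> j. 2 * pi). t = torus_of (cvec \<xi>)"
proof -
  obtain x where x: "t = torus_of (cvec x)"
    using assms by (auto simp: rtorus_def)
  define m where "m = (\<chi> j. \<lfloor>x $ j / (2 * pi)\<rfloor>)"
  define \<xi> where "\<xi> = x - (2 * pi) *\<^sub>R rvec m"
  have "0 \<le> \<xi> $ j \<and> \<xi> $ j \<le> 2 * pi" for j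
  proof -
    have "of_int (m $ j) \<le> x $ j / (2 * pi)" "x $ j / (2 * pi) \<le> of_int (m $ j) + 1"
      by (simp_all add: m_def)
    then show ?thesis
      by (simp add: \<xi>_def rvec_def field_simps)
  qed
  moreover have "cvec \<xi> - cvec x = period (- m)"
    unfolding period_minus by (simp add: \<xi>_def period_def cvec_diff)
  ultimately show ?thesis
    using x by (intro bexI[of _ \<xi>]) (auto simp: torus_of_eq_iff mem_box_cart)
qed

section \<open>Real analytic maps of the phase space that displace the actions little\<close>

text \<open>The angles sent to the target are described by their coordinates in a fundamental cube, so
  compactness of the torus becomes compactness of the cube. Local lifts of \<open>\<Psi>\<close> suffice: they give
  the continuity of the action component, and the condition on the angle component says that
  the lift differs from a fixed vector by a period, which is a closed condition because the period
  lattice is closed. The uniqueness of the angle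
  up to periods comes from the bijectivity of torus diffeomorphisms.\<close>

lemma covers_if_displacement_small:
  fixes \<Psi> :: "'n::finite phase \<Rightarrow> 'n phase"
  assumes \<Psi>: "real_analytic_symplectic V r' \<sigma>' r \<sigma> \<Psi>"
    and diffeo: "\<And>y. y \<in> real_part (cnbhd V r') \<Longrightarrow> torus_diffeo (\<lambda>x. snd (\<Psi> (cvec y, x)))"
    and displ: "sup_norm (cnbhd V r' \<times> ctorus_strip \<sigma>') (\<lambda>p. fst (\<Psi> p) - fst p) \<le> ennreal \<rho>"
    and "\<sigma>' > 0" "0 < \<rho>" "\<rho> < r''" "r'' \<le> r'"
  shows "cvec ` V \<times> rtorus \<subseteq> \<Psi> ` (cvec ` real_part (cnbhd V r'') \<times> rtorus)"
proof clarify
  fix t :: "'n ctorus" and a :: "real^'n"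
  assume t: "t \<in> rtorus" and a: "a \<in> V"
  obtain \<theta> where \<theta>: "t = torus_of (cvec \<theta>)"
    using t by (auto simp: rtorus_def)
  have near: "cvec y \<in> cnbhd V r''" if "y \<in> cball a \<rho>" for y
  proof -
    have "norm (cvec y - cvec a) \<le> \<rho>"
      using that by (simp add: norm_cvec dist_norm norm_minus_commute flip: cvec_diff)
    then have "norm (cvec y - cvec a) < r''"
      using \<open>\<rho> < r''\<close> by (rule le_less_trans)
    then show ?thesis
      using a unfolding cnbhd_def by blast
  qed
  have "cnbhd V r'' \<subseteq> cnbhd V r'"
    unfolding cnbhd_def using order_less_le_trans[OF _ \<open>r'' \<le> r'\<close>] by blast
  with near have dom: "cvec y \<in> cnbhd V r'" if "y \<in> cball a \<rho>" for y
    using that by blast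
  have strip: "cvec \<xi> \<in> strip \<sigma>'" for \<xi> :: "real^'n"
    using \<open>\<sigma>' > 0\<close> by (simp add: strip_def cvec_def)
  have rt: "torus_of (cvec \<xi>) \<in> rtorus" for \<xi> :: "real^'n"
    by (simp add: rtorus_def)
  define \<Phi> where "\<Phi> = (\<lambda>p :: (real^'n) \<times> (real^'n). \<Psi> (cvec (fst p), torus_of (cvec (snd p))))"
  have real: "fst (\<Phi> (y, \<xi>)) \<in> range cvec" if "y \<in> cball a \<rho>" for y \<xi>
  proof -
    have "\<Psi> ` (cvec ` real_part (cnbhd V r') \<times> rtorus) \<subseteq> range cvec \<times> rtorus"
      using \<Psi> by (simp add: real_analytic_symplectic_def)
    moreover have "(cvec y, torus_of (cvec \<xi>)) \<in> cvec ` real_part (cnbhd V r') \<times> rtorus"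
      using dom[OF that] rt by (simp add: real_part_def)
    ultimately have "\<Phi> (y, \<xi>) \<in> range cvec \<times> rtorus"
      unfolding \<Phi>_def fst_conv snd_conv by blast
    then show ?thesis
      by (simp add: mem_Times_iff)
  qed
  define P where "P = (\<lambda>p. \<chi> j. Re (fst (\<Phi> p) $ j))"
  have P: "fst (\<Phi> (y, \<xi>)) = cvec (P (y, \<xi>))" if "y \<in> cball a \<rho>" for y \<xi>
    using real[OF that, of \<xi>] by (auto simp: P_def cvec_def)
  have lift: "\<exists>U F. open U \<and> p \<in> U \<and> continuous_on U F \<and>
      (\<forall>q\<in>U. \<Phi> q = (fst (F q), torus_of (snd (F q))))"
    if p: "p \<in> cball a \<rho> \<times> UNIV" for p
  proof -
    let ?c = "\<lambda>q :: (real^'n) \<times> (real^'n). (cvec (fst q), cvec (snd q))"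
    have "?c p \<in> cnbhd V r' \<times> strip \<sigma>'"
      using p dom strip by auto
    then obtain U F where U: "open U" "?c p \<in> U"
      and F: "\<And>y x. (y, x) \<in> U \<Longrightarrow> \<Psi> (y, torus_of x) = (fst (F (y, x)), torus_of (snd (F (y, x))))"
      and der: "\<And>q. q \<in> U \<Longrightarrow> \<exists>D. (F has_derivative D) (at q)"
      using \<Psi> unfolding real_analytic_symplectic_def by (smt (verit) case_prodD)
    have cc: "continuous_on S ?c" for S
      by (intro continuous_intros)
    have contF: "continuous_on U F"
      using der by (meson continuous_at_imp_continuous_on has_derivative_continuous)
    have "open (?c -` U)"
      using U(1) cc by (rule open_vimage)
    moreover have "continuous_on (?c -` U) (\<lambda>q. F (?c q))"
      by (rule continuous_on_compose2[OF contF cc]) auto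
    ultimately show ?thesis
      using U F by (intro exI[of _ "?c -` U"] exI[of _ "\<lambda>q. F (?c q)"]) (auto simp: \<Phi>_def)
  qed
  let ?D = "cball a \<rho> \<times> cbox 0 (\<chi> j. 2 * pi) :: ((real^'n) \<times> (real^'n)) set"
  define A where "A = {p \<in> ?D. snd (\<Phi> p) = t}"
  have cont: "continuous_on ?D P"
    unfolding continuous_on_eq_continuous_within
  proof
    fix p assume "p \<in> ?D"
    then have "p \<in> cball a \<rho> \<times> UNIV"
      by auto
    from lift[OF this] obtain U F where U: "open U" "p \<in> U" "continuous_on U F"
      "\<And>q. q \<in> U \<Longrightarrow> \<Phi> q = (fst (F q), torus_of (snd (F q)))"
      by metis
    have "continuous_on U (\<lambda>q. \<chi> j. Re (fst (F q) $ j))"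
      by (intro continuous_intros U(3))
    then have "continuous_on U P"
      by (rule continuous_on_eq) (simp add: P_def U(4))
    then show "continuous (at p within ?D) P"
      using U(1,2) by (simp add: continuous_on_eq_continuous_at continuous_at_imp_continuous_at_within)
  qed
  have "closed A"
    unfolding closed_sequential_limits
  proof (intro allI impI, elim conjE)
    fix X p assume XA: "\<forall>i. X i \<in> A" and lim: "X \<longlonglongrightarrow> p"
    have "closed ?D"
      by (intro closed_Times closed_cball closed_cbox)
    then have pD: "p \<in> ?D"
      by (rule closed_sequentially[OF _ _ lim]) (use XA in \<open>simp add: A_def\<close>)
    then have "p \<in> cball a \<rho> \<times> UNIV"
      by auto
    from lift[OF this] obtain U F where U: "open U" "p \<in> U" "continuous_on U F"
      "\<And>q. q \<in> U \<Longrightarrow> \<Phi> q = (fst (F q), torus_of (snd (F q)))"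
      by metis
    have "isCont F p"
      using U by (simp add: continuous_on_eq_continuous_at)
    then have limF: "(\<lambda>i. cvec \<theta> - snd (F (X i))) \<longlonglongrightarrow> cvec \<theta> - snd (F p)"
      by (intro tendsto_intros isCont_tendsto_compose[OF _ lim])
    have "\<forall>\<^sub>F i in sequentially. X i \<in> U"
      using lim U(1,2) by (rule topological_tendstoD)
    then have "\<forall>\<^sub>F i in sequentially. cvec \<theta> - snd (F (X i)) \<in> range period"
    proof eventually_elim
      case (elim i)
      have "snd (\<Phi> (X i)) = t"
        using XA by (simp add: A_def)
      then show ?case
        using U(4)[OF elim] by (simp add: \<theta> torus_of_eq_iff)
    qed
    then have "cvec \<theta> - snd (F p) \<in> range period"
      using Lim_in_closed_set[OF closed_periods _ trivial_limit_sequentially limF] by blast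
    then show "p \<in> A"
      using pD U(4)[OF U(2)] by (simp add: A_def \<theta> torus_of_eq_iff)
  qed
  moreover have "A \<subseteq> ?D"
    by (auto simp: A_def)
  ultimately have "compact A"
    by (metis compact_Int_closed compact_Times compact_cball compact_cbox inf.absorb2)
  \<comment> \<open>Surjectivity puts a point of \<open>A\<close> over every action of the ball; injectivity makes any two of
    them represent the same point of the torus.\<close>
  have bij: "bij_betw (\<lambda>x. snd (\<Psi> (cvec y, x))) rtorus rtorus" if "y \<in> cball a \<rho>" for y
    using diffeo[of y] dom[OF that] by (simp add: torus_diffeo_def real_part_def)
  have "fst ` A = cball a \<rho>"
  proof (intro equalityI subsetI)
    fix y assume y: "y \<in> cball a \<rho>"
    have "t \<in> (\<lambda>x. snd (\<Psi> (cvec y, x))) ` rtorus"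
      using bij_betw_imp_surj_on[OF bij[OF y]] t by simp
    then obtain x where x: "x \<in> rtorus" "t = snd (\<Psi> (cvec y, x))"
      by (rule imageE)
    obtain \<xi> where "\<xi> \<in> cbox 0 (\<chi> j. 2 * pi)" "x = torus_of (cvec \<xi>)"
      using rtorus_representative[OF x(1)] by blast
    then have "(y, \<xi>) \<in> A"
      using x(2) y by (simp add: A_def \<Phi>_def)
    then show "y \<in> fst ` A"
      by force
  qed (auto simp: A_def)
  have const: "P (y, \<xi>) = P (y, \<xi>')" if "(y, \<xi>) \<in> A" "(y, \<xi>') \<in> A" for y \<xi> \<xi>'
  proof -
    have y: "y \<in> cball a \<rho>"
      using that by (auto simp: A_def)
    have "torus_of (cvec \<xi>) = torus_of (cvec \<xi>')"
      by (rule inj_onD[OF bij_betw_imp_inj_on[OF bij[OF y]] _ rt rt])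
        (use that in \<open>simp add: A_def \<Phi>_def\<close>)
    then show ?thesis
      by (simp add: P_def \<Phi>_def)
  qed
  have small: "norm (P (y, \<xi>) - y) \<le> \<rho>" if "(y, \<xi>) \<in> A" for y \<xi>
  proof -
    have y: "y \<in> cball a \<rho>"
      using that by (auto simp: A_def)
    have "torus_of (cvec \<xi>) \<in> ctorus_strip \<sigma>'"
      using strip by (simp add: ctorus_strip_def)
    then have "ennreal (norm (fst (\<Phi> (y, \<xi>)) - cvec y)) \<le> ennreal \<rho>"
      using dom[OF y] unfolding \<Phi>_def
      by (intro order_trans[OF _ displ[unfolded sup_norm_def]] SUP_upper2[of "(cvec y, torus_of (cvec \<xi>))"]) auto
    then show ?thesis
      using \<open>0 < \<rho>\<close> by (simp add: P[OF y] norm_cvec flip: cvec_diff)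
  qed
  have "continuous_on A P"
    using cont \<open>A \<subseteq> ?D\<close> by (rule continuous_on_subset)
  from hits_centre_if_displacement_small[OF \<open>compact A\<close> this \<open>fst ` A = cball a \<rho>\<close> \<open>0 < \<rho>\<close> const small]
  obtain y \<xi> where A: "(y, \<xi>) \<in> A" and "P (y, \<xi>) = a"
    by blast
  then have y: "y \<in> cball a \<rho>"
    by (auto simp: A_def)
  have "\<Psi> (cvec y, torus_of (cvec \<xi>)) = (cvec a, t)"
    using P[OF y, of \<xi>] A \<open>P (y, \<xi>) = a\<close> by (simp add: A_def \<Phi>_def prod_eq_iff)
  then show "(cvec a, t) \<in> \<Psi> ` (cvec ` real_part (cnbhd V r'') \<times> rtorus)"
    using near[OF y] rt by (intro image_eqI[where x = "(cvec y, torus_of (cvec \<xi>))"] SigmaI imageI)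
      (simp_all add: real_part_def)
qed

section \<open>Integer generators up to a given order\<close>

lemma finite_gens_upto: "finite (gens_upto K :: ((int, 'n::{finite,linorder}) vec) set)"
proof -
  let ?F = "(UNIV :: 'n set) \<rightarrow>\<^sub>E {-\<lfloor>K\<rfloor>..\<lfloor>K\<rfloor>}"
  have "gens_upto K \<subseteq> vec_lambda ` ?F"
  proof
    fix k :: "(int, 'n) vec" assume "k \<in> gens_upto K"
    then have "norm1 k \<le> K"
      by (simp add: gens_upto_def)
    have "k $ j \<in> {-\<lfloor>K\<rfloor>..\<lfloor>K\<rfloor>}" for j
    proof -
      have "real_of_int \<bar>k $ j\<bar> \<le> norm1 k"
        unfolding norm1_def by (rule member_le_sum) auto
      then have "\<bar>k $ j\<bar> \<le> \<lfloor>K\<rfloor>"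
        using \<open>norm1 k \<le> K\<close> by (simp add: le_floor_iff)
      then show ?thesis
        by auto
    qed
    then have "vec_nth k \<in> ?F"
      unfolding PiE_UNIV_domain by blast
    then show "k \<in> vec_lambda ` ?F"
      by (intro image_eqI[where x = "vec_nth k"]) (simp_all add: vec_nth_inverse)
  qed
  moreover have "finite ?F"
    by (intro finite_PiE) auto
  ultimately show ?thesis
    by (meson finite_imageI finite_subset)
qed

lemma gens_upto_nonempty:
  assumes "K \<ge> 1"
  shows "gens_upto K \<noteq> ({} :: ((int, 'n::{finite,linorder}) vec) set)"
proof -
  obtain j :: 'n where True by simp
  have nth: "axis j (1::int) $ i = (if i = j then 1 else 0)" for i
    by (simp add: axis_def)
  have "Gcd (range (\<lambda>i. axis j (1::int) $ i)) dvd axis j (1::int) $ j"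
    by (intro Gcd_dvd) blast
  then have "Gcd (range (\<lambda>i. axis j (1::int) $ i)) = 1"
    by (simp add: nth)
  moreover have "norm1 (axis j 1) = 1"
    by (simp add: norm1_def nth if_distrib cong: if_cong)
  ultimately have "axis j 1 \<in> gens_upto K"
    using assms by (auto simp: gens_upto_def gens_def nth intro!: exI[of _ j])
  then show ?thesis
    by blast
qed

lemma norm_rvec_pos: "k \<noteq> 0 \<Longrightarrow> norm (rvec k) > 0"
  by (auto simp: rvec_def vec_eq_iff)

lemma shrink_pos: "s > 0 \<Longrightarrow> K > 1 \<Longrightarrow> shrink s K > 0"
  by (simp add: shrink_def)

lemma displacement_lt_quarter:
  fixes r K :: real
  assumes "r > 0" "K \<ge> 1"
  shows "r / (2 ^ 7 * K) < r / 2 / 2"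
proof -
  have "r / (2 ^ 7 * K) \<le> r / 2 ^ 7"
    using assms by (intro divide_left_mono) auto
  with \<open>r > 0\<close> show ?thesis
    by simp
qed

section \<open>The covering statement\<close>

lemma R2_covered:
  assumes "\<alpha> > 0" "Ko \<ge> 1"
  shows "R2 \<alpha> Ko K \<subseteq>
    (\<Union>k \<in> (gens_upto Ko :: ((int, 'n::{finite,linorder}) vec) set).
       \<Union>l \<in> gens_upto K - int_line k. R2kl \<alpha> K k l)"
proof
  fix y :: "(real, 'n) vec" assume y: "y \<in> R2 \<alpha> Ko K"
  let ?M = "(\<lambda>k. \<bar>y \<bullet> rvec k\<bar>) ` gens_upto Ko"
  have "y \<in> ball 0 1" "\<not> Min ?M > \<alpha> / 2"
    using y by (auto simp: R2_def R0_def)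
  moreover have "Min ?M \<in> ?M"
    using finite_gens_upto gens_upto_nonempty[OF \<open>Ko \<ge> 1\<close>] by (intro Min_in) auto
  ultimately obtain k where k: "k \<in> gens_upto Ko" "\<bar>y \<bullet> rvec k\<bar> \<le> \<alpha> / 2"
    by (metis (no_types, lifting) imageE not_less)
  then have "\<bar>y \<bullet> rvec k\<bar> < \<alpha>"
    using \<open>\<alpha> > 0\<close> by simp
  moreover have "y \<notin> R1k \<alpha> K k"
    using y k(1) by (auto simp: R2_def R1_def)
  ultimately obtain l where "l \<in> gens_upto K - int_line k" "y \<in> R2kl \<alpha> K k l"
    using \<open>y \<in> ball 0 1\<close> by (force simp: R1k_def R2kl_def not_less)
  with k(1) show "y \<in> (\<Union>k \<in> gens_upto Ko. \<Union>l \<in> gens_upto K - int_line k. R2kl \<alpha> K k l)"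
    by blast
qed

theorem lemma2p3:
  fixes f :: "real^'n::{finite,linorder} \<Rightarrow> real"
    and s \<epsilon> Ko K \<alpha> :: real
    and b0 :: "nat \<Rightarrow> real \<Rightarrow> real"
    and \<Psi>o :: "'n phase \<Rightarrow> 'n phase"
    and \<Psi> :: "(int, 'n) vec \<Rightarrow> 'n phase \<Rightarrow> 'n phase"
  assumes "CARD('n) \<ge> 2" and "s > 0" and "0 < \<epsilon>" and "\<epsilon> < 1"
    and "f \<in> analytic_class s"
    and "K \<ge> 6 * Ko" and "6 * Ko \<ge> 12"
    and "b0 CARD('n) s > 1" and "Ko \<ge> b0 CARD('n) s"
    and "\<alpha> = sqrt \<epsilon> * K powr (9 / 2 * real CARD('n) + 2)"
    and "averaging_map_o f s \<epsilon> Ko K \<alpha> \<Psi>o"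
    and "\<forall>k \<in> gens_upto Ko. averaging_map_k f s \<epsilon> K \<alpha> k (\<Psi> k)"
  shows "cvec ` R0 \<alpha> Ko \<times> rtorus \<subseteq> \<Psi>o ` (cvec ` R0_tilde \<alpha> Ko \<times> rtorus)
    \<and> (\<forall>k \<in> gens_upto Ko.
           cvec ` R1k \<alpha> K k \<times> rtorus \<subseteq> \<Psi> k ` (cvec ` R1k_tilde \<alpha> K k \<times> rtorus))
    \<and> R2 \<alpha> Ko K \<subseteq>
           (\<Union>k \<in> (gens_upto Ko :: ((int, 'n) vec) set). \<Union>l \<in> gens_upto K - int_line k. R2kl \<alpha> K k l)"
proof (intro conjI ballI)
  have Ko: "Ko \<ge> 2" and K: "K \<ge> 12"
    using assms by auto
  have "\<alpha> > 0"
    using assms K by simp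
  show "R2 \<alpha> Ko K \<subseteq>
      (\<Union>k \<in> (gens_upto Ko :: ((int, 'n) vec) set). \<Union>l \<in> gens_upto K - int_line k. R2kl \<alpha> K k l)"
    using \<open>\<alpha> > 0\<close> Ko by (intro R2_covered) auto
  have r: "0 < rad_o \<alpha> Ko"
    using \<open>\<alpha> > 0\<close> Ko by (simp add: rad_o_def)
  show "cvec ` R0 \<alpha> Ko \<times> rtorus \<subseteq> \<Psi>o ` (cvec ` R0_tilde \<alpha> Ko \<times> rtorus)"
    unfolding R0_tilde_def
  proof (rule covers_if_displacement_small)
    show "rad_o \<alpha> Ko / (2 ^ 7 * Ko) < rad_o \<alpha> Ko / 2 / 2"
      using r Ko by (intro displacement_lt_quarter) auto
    show "shrink (shrink s Ko) Ko > 0"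
      using Ko \<open>s > 0\<close> by (intro shrink_pos) auto
  qed (use assms(11) r Ko in \<open>auto simp: averaging_map_o_def Let_def\<close>)
  fix k :: "(int, 'n) vec" assume k: "k \<in> gens_upto Ko"
  then have r: "0 < rad \<alpha> k"
    using \<open>\<alpha> > 0\<close> norm_rvec_pos[of k] by (simp add: rad_def gens_upto_def gens_def)
  have avg: "averaging_map_k f s \<epsilon> K \<alpha> k (\<Psi> k)"
    using assms(12) k by blast
  show "cvec ` R1k \<alpha> K k \<times> rtorus \<subseteq> \<Psi> k ` (cvec ` R1k_tilde \<alpha> K k \<times> rtorus)"
    unfolding R1k_tilde_def
  proof (rule covers_if_displacement_small)
    show "rad \<alpha> k / (2 ^ 7 * K) < rad \<alpha> k / 2 / 2"
      using r K by (intro displacement_lt_quarter) auto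
    show "shrink (shrink s K) K > 0"
      using K \<open>s > 0\<close> by (intro shrink_pos) auto
  qed (use avg r K in \<open>auto simp: averaging_map_k_def Let_def\<close>)
qed

end
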